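(* For every io-disjoint FLIF expression $\alpha$ over a database schema $\mathcal{S}$ there exists a plan $E_\alpha$ over $\mathcal{S}$ with input variables $I(\alpha)$ such that $\mathrm{Eval}_\alpha(D,N) = E_\alpha(D,N)$ for every instance $D$ of $\mathcal{S}$ and every set $N$ of valuations on $I(\alpha)$. Here $\mathrm{Eval}_\alpha(D,N)=\bigcup_{\nu_{\rm in}\in N}\mathrm{Eval}_\alpha(D,\nu_{\rm in})$, where $\mathrm{Eval}_\alpha(D,\nu_{\rm in}) = \{\nu_{\rm out}|_{\mathit{vars}(\alpha)} \mid \exists \nu_{\rm in}' : \nu_{\rm in} \subseteq \nu_{\rm in}' \text{ and } (\nu_{\rm in}',\nu_{\rm out}) \in [\![\alpha]\!]_D\}$.
   Context: FLIF expressions over a schema $\mathcal{S}$ (relation names with arities and input arities; atoms $R(\bar x;\bar y)$ with $\bar x$ the input positions) are built from atomic expressions $R(\bar x;\bar y)$, $(x=y)$, $(x=c)$, $(x:=y)$, $(x:=c)$ using composition $;$, union $\cup$ and difference $-$. Their semantics $[\![\alpha]\!]_D$ on an instance $D$ is a set of pairs of valuations: $R(\bar x;\bar y)$ gives pairs $(\nu_1,\nu_2)$ with $\nu_1(\bar x)\cdot\nu_2(\bar y)\in D(R)$ and $\nu_1,\nu_2$ agreeing outside $\bar y$; equality tests give identical pairs satisfying the test; assignments update one variable; composition is relational composition, union and difference are set operations. $\mathit{vars}(\alpha)$ is the set of variables in $\alpha$. Input/output variables: $I(R(\bar x;\bar y))=X$, $O=Y$ (variable sets of $\bar x,\bar y$);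 $I(x=y)=\{x,y\}$, $O=\emptyset$; $I(x:=y)=\{y\}$, $O=\{x\}$; $I(x=c)=\{x\}$, $O=\emptyset$; $I(x:=c)=\emptyset$, $O=\{x\}$; $I(\alpha_1;\alpha_2)=I(\alpha_1)\cup(I(\alpha_2)\setminus O(\alpha_1))$, $O=O(\alpha_1)\cup O(\alpha_2)$; $I(\alpha_1\cup\alpha_2)=I(\alpha_1-\alpha_2)=I(\alpha_1)\cup I(\alpha_2)\cup(O(\alpha_1)\mathbin{\triangle}O(\alpha_2))$, with $O(\alpha_1\cup\alpha_2)=O(\alpha_1)\cup O(\alpha_2)$ and $O(\alpha_1-\alpha_2)=O(\alpha_1)$. An expression is io-disjoint if $I(\beta)\cap O(\beta)=\emptyset$ for every subexpression $\beta$ (including itself). Plans (named relational algebra; valuations on a variable set viewed as tuples over that schema): for a finite set $I$, a plan over $\mathcal{S}$ with input variables $I$ is built as follows: the relation name $\mathit{In}$ with schema $I$ is a plan; if $E$ is a plan with output schema $Z$ and $R(\bar x;\bar y)$ is an atomic io-disjoint expression with $X\subseteq Z$ and $Z\cap Y=\emptyset$, then $E \overset{\rm access}{\bowtie} R(\bar x;\bar y)$ is a plan with schema $Z\cup Y$, whose value is $\{\nu \text{ on } Z\cup Y \mid \nu|_Z\in E,\ \nu(\bar x)\cdot\nu(\bar y)\in D(R)\}$; plans are closed under union, difference (same schemas), natural join, projection, selection, and generalized projection $\pi_{Z,x:=y}$, $\pi_{Z,x:=c}$ (adding a new attribute $x$ equal to $y$ or to constant $c$). $E(D,N)$ is the result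 of evaluating $E$ on $D$ with $\mathit{In}$ instantiated by $N$. *)

theory Defs
  imports Main
begin

text \<open>
  Type variables: \<open>'r\<close> relation names, \<open>'v\<close> variables, \<open>'d\<close> the universe of atomic data elements.
  Valuations on all variables are total functions \<open>'v \<Rightarrow> 'd\<close>; a valuation on a set \<open>Z\<close> of variables
  is a partial map with domain \<open>Z\<close>.
\<close>

section \<open>Schemas and instances\<close>

record 'r schema =
  names :: "'r set"
  arity :: "'r \<Rightarrow> nat"
  input_arity :: "'r \<Rightarrow> nat"

definition valid_schema :: "'r schema \<Rightarrow> bool" where
  "valid_schema S \<longleftrightarrow> (\<forall>R \<in> names S. input_arity S R \<le> arity S R)"

definition is_instance :: "'r schema \<Rightarrow> ('r \<Rightarrow> 'd list set) \<Rightarrow> bool" where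
  "is_instance S D \<longleftrightarrow> (\<forall>R \<in> names S. \<forall>t \<in> D R. length t = arity S R)"

text \<open>The input positions of a relation name are its first \<open>input_arity\<close> positions.\<close>

definition atom_over :: "'r schema \<Rightarrow> 'r \<Rightarrow> 'v list \<Rightarrow> 'v list \<Rightarrow> bool" where
  "atom_over S R xs ys \<longleftrightarrow> R \<in> names S \<and> length xs = input_arity S R
     \<and> length xs + length ys = arity S R"

section \<open>FLIF expressions\<close>

datatype ('r, 'v, 'd) flif =
    Atom 'r "'v list" "'v list"
  | EqVar 'v 'v
  | EqConst 'v 'd
  | AssignVar 'v 'v
  | AssignConst 'v 'd
  | Comp "('r, 'v, 'd) flif" "('r, 'v, 'd) flif"
  | Union "('r, 'v, 'd) flif" "('r, 'v, 'd) flif"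
  | Diff "('r, 'v, 'd) flif" "('r, 'v, 'd) flif"

primrec flif_over :: "'r schema \<Rightarrow> ('r, 'v, 'd) flif \<Rightarrow> bool" where
  "flif_over S (Atom R xs ys) \<longleftrightarrow> atom_over S R xs ys"
| "flif_over S (EqVar x y) \<longleftrightarrow> True"
| "flif_over S (EqConst x c) \<longleftrightarrow> True"
| "flif_over S (AssignVar x y) \<longleftrightarrow> True"
| "flif_over S (AssignConst x c) \<longleftrightarrow> True"
| "flif_over S (Comp a b) \<longleftrightarrow> flif_over S a \<and> flif_over S b"
| "flif_over S (Union a b) \<longleftrightarrow> flif_over S a \<and> flif_over S b"
| "flif_over S (Diff a b) \<longleftrightarrow> flif_over S a \<and> flif_over S b"

primrec vars :: "('r, 'v, 'd) flif \<Rightarrow> 'v set" where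
  "vars (Atom R xs ys) = set xs \<union> set ys"
| "vars (EqVar x y) = {x, y}"
| "vars (EqConst x c) = {x}"
| "vars (AssignVar x y) = {x, y}"
| "vars (AssignConst x c) = {x}"
| "vars (Comp a b) = vars a \<union> vars b"
| "vars (Union a b) = vars a \<union> vars b"
| "vars (Diff a b) = vars a \<union> vars b"

primrec sem :: "('r \<Rightarrow> 'd list set) \<Rightarrow> ('r, 'v, 'd) flif \<Rightarrow> (('v \<Rightarrow> 'd) \<times> ('v \<Rightarrow> 'd)) set" where
  "sem D (Atom R xs ys) =
     {(\<nu>1, \<nu>2). map \<nu>1 xs @ map \<nu>2 ys \<in> D R \<and> (\<forall>v. v \<notin> set ys \<longrightarrow> \<nu>1 v = \<nu>2 v)}"
| "sem D (EqVar x y) = {(\<nu>1, \<nu>2). \<nu>1 = \<nu>2 \<and> \<nu>1 x = \<nu>1 y}"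
| "sem D (EqConst x c) = {(\<nu>1, \<nu>2). \<nu>1 = \<nu>2 \<and> \<nu>1 x = c}"
| "sem D (AssignVar x y) = {(\<nu>1, \<nu>2). \<nu>2 = \<nu>1(x := \<nu>1 y)}"
| "sem D (AssignConst x c) = {(\<nu>1, \<nu>2). \<nu>2 = \<nu>1(x := c)}"
| "sem D (Comp a b) = sem D a O sem D b"
| "sem D (Union a b) = sem D a \<union> sem D b"
| "sem D (Diff a b) = sem D a - sem D b"

primrec out_vars :: "('r, 'v, 'd) flif \<Rightarrow> 'v set" where
  "out_vars (Atom R xs ys) = set ys"
| "out_vars (EqVar x y) = {}"
| "out_vars (EqConst x c) = {}"
| "out_vars (AssignVar x y) = {x}"
| "out_vars (AssignConst x c) = {x}"
| "out_vars (Comp a b) = out_vars a \<union> out_vars b"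
| "out_vars (Union a b) = out_vars a \<union> out_vars b"
| "out_vars (Diff a b) = out_vars a"

primrec in_vars :: "('r, 'v, 'd) flif \<Rightarrow> 'v set" where
  "in_vars (Atom R xs ys) = set xs"
| "in_vars (EqVar x y) = {x, y}"
| "in_vars (EqConst x c) = {x}"
| "in_vars (AssignVar x y) = {y}"
| "in_vars (AssignConst x c) = {}"
| "in_vars (Comp a b) = in_vars a \<union> (in_vars b - out_vars a)"
| "in_vars (Union a b) = in_vars a \<union> in_vars b \<union> sym_diff (out_vars a) (out_vars b)"
| "in_vars (Diff a b) = in_vars a \<union> in_vars b \<union> sym_diff (out_vars a) (out_vars b)"

primrec subexprs :: "('r, 'v, 'd) flif \<Rightarrow> ('r, 'v, 'd) flif set" where
  "subexprs (Atom R xs ys) = {Atom R xs ys}"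
| "subexprs (EqVar x y) = {EqVar x y}"
| "subexprs (EqConst x c) = {EqConst x c}"
| "subexprs (AssignVar x y) = {AssignVar x y}"
| "subexprs (AssignConst x c) = {AssignConst x c}"
| "subexprs (Comp a b) = {Comp a b} \<union> subexprs a \<union> subexprs b"
| "subexprs (Union a b) = {Union a b} \<union> subexprs a \<union> subexprs b"
| "subexprs (Diff a b) = {Diff a b} \<union> subexprs a \<union> subexprs b"

definition io_disjoint :: "('r, 'v, 'd) flif \<Rightarrow> bool" where
  "io_disjoint \<alpha> \<longleftrightarrow> (\<forall>\<beta> \<in> subexprs \<alpha>. in_vars \<beta> \<inter> out_vars \<beta> = {})"

section \<open>The evaluation problem\<close>

definition valuations_on :: "'v set \<Rightarrow> ('v \<rightharpoonup> 'd) set" where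
  "valuations_on Z = {\<mu>. dom \<mu> = Z}"

text \<open>A total valuation \<open>\<nu>\<close>, seen as a partial map, is \<open>Some \<circ> \<nu>\<close>.\<close>

definition Eval1 :: "('r, 'v, 'd) flif \<Rightarrow> ('r \<Rightarrow> 'd list set) \<Rightarrow> ('v \<rightharpoonup> 'd) \<Rightarrow> ('v \<rightharpoonup> 'd) set" where
  "Eval1 \<alpha> D \<nu>in =
     {(Some \<circ> \<nu>out) |` vars \<alpha> | \<nu>out. \<exists>\<nu>in'. \<nu>in \<subseteq>\<^sub>m (Some \<circ> \<nu>in') \<and> (\<nu>in', \<nu>out) \<in> sem D \<alpha>}"

definition Eval :: "('r, 'v, 'd) flif \<Rightarrow> ('r \<Rightarrow> 'd list set) \<Rightarrow> ('v \<rightharpoonup> 'd) set \<Rightarrow> ('v \<rightharpoonup> 'd) set" where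
  "Eval \<alpha> D N = (\<Union>\<nu>in \<in> N. Eval1 \<alpha> D \<nu>in)"

section \<open>Plans\<close>

datatype ('r, 'v, 'd) plan =
    In
  | Access "('r, 'v, 'd) plan" 'r "'v list" "'v list"
  | PUnion "('r, 'v, 'd) plan" "('r, 'v, 'd) plan"
  | PDiff "('r, 'v, 'd) plan" "('r, 'v, 'd) plan"
  | Join "('r, 'v, 'd) plan" "('r, 'v, 'd) plan"
  | Project "'v set" "('r, 'v, 'd) plan"
  | SelectVar 'v 'v "('r, 'v, 'd) plan"
  | SelectConst 'v 'd "('r, 'v, 'd) plan"
  | GenProjVar "'v set" 'v 'v "('r, 'v, 'd) plan"
  | GenProjConst "'v set" 'v 'd "('r, 'v, 'd) plan"

text \<open>The output schema of a plan with input variables \<open>I\<close>.\<close>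

primrec attrs :: "'v set \<Rightarrow> ('r, 'v, 'd) plan \<Rightarrow> 'v set" where
  "attrs I In = I"
| "attrs I (Access E R xs ys) = attrs I E \<union> set ys"
| "attrs I (PUnion E F) = attrs I E"
| "attrs I (PDiff E F) = attrs I E"
| "attrs I (Join E F) = attrs I E \<union> attrs I F"
| "attrs I (Project Z E) = Z"
| "attrs I (SelectVar x y E) = attrs I E"
| "attrs I (SelectConst x c E) = attrs I E"
| "attrs I (GenProjVar Z x y E) = insert x Z"
| "attrs I (GenProjConst Z x c E) = insert x Z"

text \<open>
  The generalized projection \<open>\<pi>\<^bsub>Z,x:=y\<^esub>\<close> keeps the attributes \<open>Z\<close> and adds \<open>x\<close>,
  which must not be an attribute of the argument, with the value of the attribute \<open>y\<close>.
\<close>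

primrec wf_plan :: "'r schema \<Rightarrow> 'v set \<Rightarrow> ('r, 'v, 'd) plan \<Rightarrow> bool" where
  "wf_plan S I In \<longleftrightarrow> True"
| "wf_plan S I (Access E R xs ys) \<longleftrightarrow> wf_plan S I E \<and> atom_over S R xs ys
     \<and> io_disjoint (Atom R xs ys :: ('r, 'v, 'd) flif)
     \<and> set xs \<subseteq> attrs I E \<and> attrs I E \<inter> set ys = {}"
| "wf_plan S I (PUnion E F) \<longleftrightarrow> wf_plan S I E \<and> wf_plan S I F \<and> attrs I E = attrs I F"
| "wf_plan S I (PDiff E F) \<longleftrightarrow> wf_plan S I E \<and> wf_plan S I F \<and> attrs I E = attrs I F"
| "wf_plan S I (Join E F) \<longleftrightarrow> wf_plan S I E \<and> wf_plan S I F"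
| "wf_plan S I (Project Z E) \<longleftrightarrow> wf_plan S I E \<and> Z \<subseteq> attrs I E"
| "wf_plan S I (SelectVar x y E) \<longleftrightarrow> wf_plan S I E \<and> x \<in> attrs I E \<and> y \<in> attrs I E"
| "wf_plan S I (SelectConst x c E) \<longleftrightarrow> wf_plan S I E \<and> x \<in> attrs I E"
| "wf_plan S I (GenProjVar Z x y E) \<longleftrightarrow>
     wf_plan S I E \<and> Z \<subseteq> attrs I E \<and> y \<in> attrs I E \<and> x \<notin> attrs I E"
| "wf_plan S I (GenProjConst Z x c E) \<longleftrightarrow>
     wf_plan S I E \<and> Z \<subseteq> attrs I E \<and> x \<notin> attrs I E"

definition is_plan :: "'r schema \<Rightarrow> 'v set \<Rightarrow> ('r, 'v, 'd) plan \<Rightarrow> bool" where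
  "is_plan S I E \<longleftrightarrow> finite I \<and> wf_plan S I E"

primrec plan_eval :: "'v set \<Rightarrow> ('r, 'v, 'd) plan \<Rightarrow> ('r \<Rightarrow> 'd list set) \<Rightarrow> ('v \<rightharpoonup> 'd) set
    \<Rightarrow> ('v \<rightharpoonup> 'd) set" where
  "plan_eval I In D N = N"
| "plan_eval I (Access E R xs ys) D N =
     {\<mu> \<in> valuations_on (attrs I E \<union> set ys).
        \<mu> |` attrs I E \<in> plan_eval I E D N
        \<and> map (the \<circ> \<mu>) xs @ map (the \<circ> \<mu>) ys \<in> D R}"
| "plan_eval I (PUnion E F) D N = plan_eval I E D N \<union> plan_eval I F D N"
| "plan_eval I (PDiff E F) D N = plan_eval I E D N - plan_eval I F D N"
| "plan_eval I (Join E F) D N =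
     {\<mu> \<in> valuations_on (attrs I E \<union> attrs I F).
        \<mu> |` attrs I E \<in> plan_eval I E D N \<and> \<mu> |` attrs I F \<in> plan_eval I F D N}"
| "plan_eval I (Project Z E) D N = {\<mu> |` Z | \<mu>. \<mu> \<in> plan_eval I E D N}"
| "plan_eval I (SelectVar x y E) D N = {\<mu> \<in> plan_eval I E D N. \<mu> x = \<mu> y}"
| "plan_eval I (SelectConst x c E) D N = {\<mu> \<in> plan_eval I E D N. \<mu> x = Some c}"
| "plan_eval I (GenProjVar Z x y E) D N =
     {(\<mu> |` Z)(x := \<mu> y) | \<mu>. \<mu> \<in> plan_eval I E D N}"
| "plan_eval I (GenProjConst Z x c E) D N =
     {(\<mu> |` Z)(x := Some c) | \<mu>. \<mu> \<in> plan_eval I E D N}"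

end

(* For io-disjoint expressions the output valuation alone decides membership in the semantics:
   (nu1, nu2) is in sem D alpha iff nu1 and nu2 agree outside the output variables and nu2 satisfies
   a condition "holds D alpha" that depends only on its values on vars alpha. Hence Eval alpha D N
   consists of the valuations mu on vars alpha that satisfy the condition and whose restriction to
   the input variables lies in N. Such a plan is built by induction on alpha, starting from an
   arbitrary plan F (instead of In) whose schema contains the inputs and avoids the outputs of alpha:
   this generality makes a substitution of plans for In unnecessary. *)

theory Submission
  imports Defs
begin

section \<open>Semantics as a condition on the output valuation\<close>

text \<open>In the \<open>Comp\<close> clause \<open>\<nu>'\<close> stands for the intermediate
  valuation as far as \<open>a\<close> can see it: only on outputs common to \<open>a\<close> and
  \<open>b\<close> may \<open>b\<close> have overwritten what \<open>a\<close> produced, so only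
  those values are quantified.\<close>

primrec holds :: "('r \<Rightarrow> 'd list set) \<Rightarrow> ('r, 'v, 'd) flif \<Rightarrow> ('v \<Rightarrow> 'd) \<Rightarrow> bool" where
  "holds D (Atom R xs ys) \<nu> \<longleftrightarrow> map \<nu> xs @ map \<nu> ys \<in> D R"
| "holds D (EqVar x y) \<nu> \<longleftrightarrow> \<nu> x = \<nu> y"
| "holds D (EqConst x c) \<nu> \<longleftrightarrow> \<nu> x = c"
| "holds D (AssignVar x y) \<nu> \<longleftrightarrow> \<nu> x = \<nu> y"
| "holds D (AssignConst x c) \<nu> \<longleftrightarrow> \<nu> x = c"
| "holds D (Comp a b) \<nu> \<longleftrightarrow> holds D b \<nu> \<and>
     (\<exists>\<nu>'. (\<forall>v. v \<notin> out_vars a \<inter> out_vars b \<longrightarrow> \<nu>' v = \<nu> v) \<and> holds D a \<nu>')"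
| "holds D (Union a b) \<nu> \<longleftrightarrow> holds D a \<nu> \<or> holds D b \<nu>"
| "holds D (Diff a b) \<nu> \<longleftrightarrow> holds D a \<nu> \<and> \<not> holds D b \<nu>"

text \<open>Outputs of \<open>b\<close> that \<open>Diff a b\<close> drops reappear as inputs
  through the symmetric difference; inputs of \<open>b\<close> dropped by \<open>Comp a b\<close>
  are outputs of \<open>a\<close>.\<close>

lemma vars_eq_in_out: "vars \<alpha> = in_vars \<alpha> \<union> out_vars \<alpha>"
  by (induction \<alpha>) auto

lemma finite_vars: "finite (vars \<alpha>)"
  by (induction \<alpha>) auto

lemma subexprs_refl: "\<alpha> \<in> subexprs \<alpha>"
  by (cases \<alpha>) auto

lemma io_disjointD: "io_disjoint \<alpha> \<Longrightarrow> in_vars \<alpha> \<inter> out_vars \<alpha> = {}"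
  using subexprs_refl unfolding io_disjoint_def by blast

lemma io_disjoint_CompD:
  assumes "io_disjoint (Comp a b)"
  shows "io_disjoint a" "io_disjoint b" "in_vars a \<inter> out_vars b = {}"
  using assms io_disjointD[OF assms] unfolding io_disjoint_def by auto

text \<open>Any variable in the symmetric difference of the outputs would be both an input and an
  output of the union. For \<open>Diff\<close> the same argument yields only an inclusion, since
  just the outputs of \<open>a\<close> count.\<close>

lemma io_disjoint_UnionD:
  assumes "io_disjoint (Union a b)"
  shows "io_disjoint a" "io_disjoint b" "out_vars a = out_vars b"
  using assms io_disjointD[OF assms] unfolding io_disjoint_def by auto

lemma io_disjoint_DiffD:
  assumes "io_disjoint (Diff a b)"
  shows "io_disjoint a" "io_disjoint b" "out_vars a \<subseteq> out_vars b"
  using assms io_disjointD[OF assms] unfolding io_disjoint_def by auto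

text \<open>Only \<open>Comp\<close> needs work, because of its quantified valuation. This lemma
  makes the patched valuations used below interchangeable.\<close>

lemma holds_cong:
  assumes "\<And>v. v \<in> vars \<alpha> \<Longrightarrow> \<nu>1 v = \<nu>2 v"
  shows "holds D \<alpha> \<nu>1 \<longleftrightarrow> holds D \<alpha> \<nu>2"
  using assms
proof (induction \<alpha> arbitrary: \<nu>1 \<nu>2)
  case (Atom R xs ys)
  then have "map \<nu>1 xs = map \<nu>2 xs" "map \<nu>1 ys = map \<nu>2 ys" by auto
  then show ?case by (simp only: holds.simps)
next
  case (Comp a b)
  let ?C = "out_vars a \<inter> out_vars b"
  have transfer: "\<exists>\<nu>'. (\<forall>v. v \<notin> ?C \<longrightarrow> \<nu>' v = \<mu>2 v) \<and> holds D a \<nu>'"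
    if eq: "\<And>v. v \<in> vars a \<Longrightarrow> \<mu>1 v = \<mu>2 v"
      and ex: "\<exists>\<nu>'. (\<forall>v. v \<notin> ?C \<longrightarrow> \<nu>' v = \<mu>1 v) \<and> holds D a \<nu>'" for \<mu>1 \<mu>2
  proof -
    obtain \<nu> where \<nu>: "\<forall>v. v \<notin> ?C \<longrightarrow> \<nu> v = \<mu>1 v" "holds D a \<nu>"
      using ex by (elim exE conjE)
    \<comment> \<open>Keep the quantified values and rebase the rest on \<open>\<mu>2\<close>; on
      \<open>vars a\<close> nothing changes, because \<open>\<mu>1\<close> and \<open>\<mu>2\<close>
      agree there.\<close>
    let ?\<nu>' = "\<lambda>v. if v \<in> ?C then \<nu> v else \<mu>2 v"
    have "holds D a \<nu> \<longleftrightarrow> holds D a ?\<nu>'"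
      by (rule Comp.IH(1)) (simp add: eq \<nu>(1))
    then show ?thesis
      using \<nu>(2) by (intro exI[of _ ?\<nu>']) simp
  qed
  have eq: "\<nu>1 v = \<nu>2 v" if "v \<in> vars a" for v
    using Comp.prems that by simp
  have "holds D b \<nu>1 \<longleftrightarrow> holds D b \<nu>2"
    by (rule Comp.IH(2)) (simp add: Comp.prems)
  moreover have "(\<exists>\<nu>'. (\<forall>v. v \<notin> ?C \<longrightarrow> \<nu>' v = \<nu>1 v) \<and> holds D a \<nu>') \<longleftrightarrow>
      (\<exists>\<nu>'. (\<forall>v. v \<notin> ?C \<longrightarrow> \<nu>' v = \<nu>2 v) \<and> holds D a \<nu>')"
    by (intro iffI; erule transfer[rotated]) (simp_all add: eq)
  ultimately show ?case by simp
next
  case (Union a b)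
  have "holds D a \<nu>1 \<longleftrightarrow> holds D a \<nu>2" "holds D b \<nu>1 \<longleftrightarrow> holds D b \<nu>2"
    by (rule Union.IH; simp add: Union.prems)+
  then show ?case by simp
next
  case (Diff a b)
  have "holds D a \<nu>1 \<longleftrightarrow> holds D a \<nu>2" "holds D b \<nu>1 \<longleftrightarrow> holds D b \<nu>2"
    by (rule Diff.IH; simp add: Diff.prems)+
  then show ?case by simp
qed auto

text \<open>Inputs are never overwritten in an io-disjoint expression, so every test on the values
  of \<open>\<nu>1\<close> can be made on \<open>\<nu>2\<close> instead.\<close>

lemma sem_iff_holds:
  assumes "io_disjoint \<alpha>"
  shows "(\<nu>1, \<nu>2) \<in> sem D \<alpha> \<longleftrightarrow> (\<forall>v. v \<notin> out_vars \<alpha> \<longrightarrow> \<nu>1 v = \<nu>2 v) \<and> holds D \<alpha> \<nu>2"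
  using assms
proof (induction \<alpha> arbitrary: \<nu>1 \<nu>2)
  case (Atom R xs ys)
  have "map \<nu>1 xs @ map \<nu>2 ys \<in> D R \<longleftrightarrow> map \<nu>2 xs @ map \<nu>2 ys \<in> D R"
    if "\<forall>v. v \<notin> set ys \<longrightarrow> \<nu>1 v = \<nu>2 v"
  proof -
    have "map \<nu>1 xs = map \<nu>2 xs" using io_disjointD[OF Atom] that by auto
    then show ?thesis by (simp only:)
  qed
  then show ?case by auto
next
  case (AssignVar x y)
  then show ?case using io_disjointD[OF AssignVar] by (auto simp: fun_eq_iff)
next
  case (Comp a b)
  note io = io_disjoint_CompD[OF Comp.prems]
  have sem: "(\<nu>1, \<nu>2) \<in> sem D (Comp a b) \<longleftrightarrow>
      (\<exists>\<nu>. (\<forall>v. v \<notin> out_vars a \<longrightarrow> \<nu>1 v = \<nu> v) \<and> holds D a \<nu> \<and>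
           (\<forall>v. v \<notin> out_vars b \<longrightarrow> \<nu> v = \<nu>2 v) \<and> holds D b \<nu>2)"
    using Comp.IH io by (auto simp: relcomp_unfold)
  show ?case
  proof
    assume "(\<nu>1, \<nu>2) \<in> sem D (Comp a b)"
    then obtain \<nu> where \<nu>: "\<And>v. v \<notin> out_vars a \<Longrightarrow> \<nu>1 v = \<nu> v" "holds D a \<nu>"
      "\<And>v. v \<notin> out_vars b \<Longrightarrow> \<nu> v = \<nu>2 v" "holds D b \<nu>2"
      unfolding sem by auto
    \<comment> \<open>\<open>\<nu>\<close> and \<open>\<nu>2\<close> differ only on outputs of
      \<open>b\<close>, which are not inputs of \<open>a\<close>. Within \<open>vars a\<close> they
      can thus differ only on common outputs, where the value of \<open>\<nu>\<close> is
      kept.\<close>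
    let ?\<nu>' = "\<lambda>v. if v \<in> out_vars a \<inter> out_vars b then \<nu> v else \<nu>2 v"
    have "holds D a \<nu> \<longleftrightarrow> holds D a ?\<nu>'"
      by (rule holds_cong) (use \<nu> io(3) in \<open>auto simp: vars_eq_in_out\<close>)
    then have "holds D a ?\<nu>'" using \<nu> by simp
    then show "(\<forall>v. v \<notin> out_vars (Comp a b) \<longrightarrow> \<nu>1 v = \<nu>2 v) \<and> holds D (Comp a b) \<nu>2"
      using \<nu> by (auto intro!: exI[of _ ?\<nu>'])
  next
    assume asm: "(\<forall>v. v \<notin> out_vars (Comp a b) \<longrightarrow> \<nu>1 v = \<nu>2 v) \<and> holds D (Comp a b) \<nu>2"
    then obtain \<nu>' where \<nu>': "\<And>v. v \<notin> out_vars a \<inter> out_vars b \<Longrightarrow> \<nu>' v = \<nu>2 v" "holds D a \<nu>'"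
      by auto
    \<comment> \<open>The intermediate valuation must agree with \<open>\<nu>1\<close> outside the
      outputs of \<open>a\<close>; on those outputs \<open>\<nu>'\<close> supplies values that
      satisfy \<open>a\<close> and already equal \<open>\<nu>2\<close> outside the outputs of
      \<open>b\<close>.\<close>
    let ?\<nu> = "\<lambda>v. if v \<in> out_vars a then \<nu>' v else \<nu>1 v"
    have "holds D a ?\<nu> \<longleftrightarrow> holds D a \<nu>'"
      by (rule holds_cong) (use \<nu>' asm io(3) in \<open>auto simp: vars_eq_in_out\<close>)
    then show "(\<nu>1, \<nu>2) \<in> sem D (Comp a b)"
      unfolding sem using \<nu>' asm by (intro exI[of _ ?\<nu>]) auto
  qed
next
  case (Union a b)
  then show ?case using io_disjoint_UnionD[OF Union.prems] by auto
next
  case (Diff a b)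
  then show ?case using io_disjoint_DiffD[OF Diff.prems] by auto
qed (auto simp: fun_eq_iff)

lemma Some_the_on_dom: "(Some \<circ> (the \<circ> \<mu>)) |` dom \<mu> = \<mu>"
  by (rule ext) (auto simp: restrict_map_def domIff)

text \<open>Since the inputs survive evaluation, the given input valuation can be recovered by
  restricting the result to \<open>in_vars \<alpha>\<close>.\<close>

lemma Eval_eq:
  assumes io: "io_disjoint \<alpha>" and N: "N \<subseteq> valuations_on (in_vars \<alpha>)"
  shows "Eval \<alpha> D N = {\<mu> \<in> valuations_on (vars \<alpha>). \<mu> |` in_vars \<alpha> \<in> N \<and> holds D \<alpha> (the \<circ> \<mu>)}"
    (is "_ = ?M")
proof (intro equalityI subsetI)
  fix \<mu> assume "\<mu> \<in> Eval \<alpha> D N"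
  then obtain \<nu>in \<nu> \<nu>' where \<nu>in: "\<nu>in \<in> N" "\<nu>in \<subseteq>\<^sub>m (Some \<circ> \<nu>')"
    and sem: "(\<nu>', \<nu>) \<in> sem D \<alpha>" and \<mu>: "\<mu> = (Some \<circ> \<nu>) |` vars \<alpha>"
    unfolding Eval_def Eval1_def by auto
  have agree: "\<And>v. v \<notin> out_vars \<alpha> \<Longrightarrow> \<nu>' v = \<nu> v" and h: "holds D \<alpha> \<nu>"
    using sem sem_iff_holds[OF io] by auto
  have dom: "dom \<nu>in = in_vars \<alpha>"
    using N \<nu>in by (auto simp: valuations_on_def)
  have "\<mu> |` in_vars \<alpha> = \<nu>in"
  proof
    fix v
    show "(\<mu> |` in_vars \<alpha>) v = \<nu>in v"
    proof (cases "v \<in> in_vars \<alpha>")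
      case True
      then have "\<nu>in v = Some (\<nu>' v)" using \<nu>in dom by (metis comp_apply map_le_def)
      moreover have "\<nu>' v = \<nu> v" using True agree io_disjointD[OF io] by blast
      ultimately show ?thesis
        using True by (simp add: \<mu> vars_eq_in_out)
    next
      case False
      then show ?thesis using dom by (metis domIff restrict_out)
    qed
  qed
  moreover have "holds D \<alpha> (the \<circ> \<mu>) \<longleftrightarrow> holds D \<alpha> \<nu>"
    by (rule holds_cong) (simp add: \<mu>)
  ultimately show "\<mu> \<in> ?M"
    using \<nu>in h by (auto simp: \<mu> valuations_on_def restrict_map_def split: if_splits)
next
  fix \<mu> assume \<mu>: "\<mu> \<in> ?M"
  let ?\<nu> = "the \<circ> \<mu>"
  have "\<mu> = (Some \<circ> ?\<nu>) |` vars \<alpha>"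
    using \<mu> Some_the_on_dom[of \<mu>] by (simp add: valuations_on_def)
  moreover have "\<mu> |` in_vars \<alpha> \<subseteq>\<^sub>m (Some \<circ> ?\<nu>)"
    by (auto simp: map_le_def)
  \<comment> \<open>The output valuation itself serves as the initial one: it trivially agrees with
    itself, and \<open>holds\<close> inspects only the output.\<close>
  moreover have "(?\<nu>, ?\<nu>) \<in> sem D \<alpha>"
    using \<mu> sem_iff_holds[OF io] by auto
  ultimately show "\<mu> \<in> Eval \<alpha> D N"
    using \<mu> unfolding Eval_def Eval1_def by blast
qed

section \<open>Domains of plan results and the invariant for plans\<close>

lemma image_valuations:
  assumes "\<And>\<mu>. dom \<mu> = Z \<Longrightarrow> dom (f \<mu>) = Z'" and "A \<subseteq> valuations_on Z"
  shows "{f \<mu> | \<mu>. \<mu> \<in> A} \<subseteq> valuations_on Z'"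
  using assms unfolding valuations_on_def by blast

text \<open>Well-formedness matters at the projections: attributes that are kept or copied must be
  defined in the tuples of the argument.\<close>

lemma plan_eval_valuations:
  fixes E :: "('r, 'v, 'd) plan"
  assumes "wf_plan S I E" "N \<subseteq> valuations_on I"
  shows "plan_eval I E D N \<subseteq> valuations_on (attrs I E)"
  using assms(1)
proof (induction E)
  case In
  then show ?case using assms(2) by simp
next
  case (Project Z E)
  have "dom (\<mu> |` Z) = Z" if "dom \<mu> = attrs I E" for \<mu> :: "'v \<rightharpoonup> 'd"
    using Project.prems that by auto
  moreover have "plan_eval I E D N \<subseteq> valuations_on (attrs I E)" using Project by simp
  ultimately show ?case unfolding plan_eval.simps attrs.simps by (rule image_valuations)
next
  case (GenProjVar Z x y E)
  have "dom ((\<mu> |` Z)(x := \<mu> y)) = insert x Z" if "dom \<mu> = attrs I E" for \<mu> :: "'v \<rightharpoonup> 'd"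
  proof -
    have "y \<in> dom \<mu>" "Z \<subseteq> dom \<mu>" using GenProjVar.prems that by auto
    then show ?thesis by auto
  qed
  moreover have "plan_eval I E D N \<subseteq> valuations_on (attrs I E)" using GenProjVar by simp
  ultimately show ?case unfolding plan_eval.simps attrs.simps by (rule image_valuations)
next
  case (GenProjConst Z x c E)
  have "dom ((\<mu> |` Z)(x \<mapsto> c)) = insert x Z" if "dom \<mu> = attrs I E" for \<mu> :: "'v \<rightharpoonup> 'd"
    using GenProjConst.prems that by auto
  moreover have "plan_eval I E D N \<subseteq> valuations_on (attrs I E)" using GenProjConst by simp
  ultimately show ?case unfolding plan_eval.simps attrs.simps by (rule image_valuations)
qed auto

text \<open>For \<open>F = In\<close> the set is the right-hand side of \<open>Eval_eq\<close>. When
  \<open>F\<close> covers the inputs of \<open>\<alpha>\<close>, all of \<open>vars \<alpha>\<close>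
  lies in the schema, so the value \<open>the None\<close> that \<open>the \<circ> \<mu>\<close>
  takes elsewhere is harmless.\<close>

definition implements ::
  "'r schema \<Rightarrow> 'v set \<Rightarrow> ('r, 'v, 'd) plan \<Rightarrow> ('r, 'v, 'd) flif \<Rightarrow> ('r, 'v, 'd) plan \<Rightarrow> bool" where
  "implements S I F \<alpha> E \<longleftrightarrow> wf_plan S I E \<and> attrs I E = attrs I F \<union> out_vars \<alpha> \<and>
     (\<forall>D N. N \<subseteq> valuations_on I \<longrightarrow> plan_eval I E D N =
        {\<mu> \<in> valuations_on (attrs I F \<union> out_vars \<alpha>).
           \<mu> |` attrs I F \<in> plan_eval I F D N \<and> holds D \<alpha> (the \<circ> \<mu>)})"

text \<open>By \<open>plan_eval_valuations\<close>, membership needs comparing only for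
  \<open>\<mu>\<close> with the expected domain.\<close>

lemma implementsI:
  fixes E F :: "('r, 'v, 'd) plan"
  assumes "wf_plan S I E" "attrs I E = attrs I F \<union> out_vars \<alpha>"
    and "\<And>D N \<mu>. N \<subseteq> valuations_on I \<Longrightarrow> dom \<mu> = attrs I F \<union> out_vars \<alpha> \<Longrightarrow>
      \<mu> \<in> plan_eval I E D N \<longleftrightarrow> \<mu> |` attrs I F \<in> plan_eval I F D N \<and> holds D \<alpha> (the \<circ> \<mu>)"
  shows "implements S I F \<alpha> E"
  unfolding implements_def
proof (intro conjI allI impI assms(1,2))
  fix D and N :: "('v \<rightharpoonup> 'd) set"
  assume N: "N \<subseteq> valuations_on I"
  show "plan_eval I E D N = {\<mu> \<in> valuations_on (attrs I F \<union> out_vars \<alpha>).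
           \<mu> |` attrs I F \<in> plan_eval I F D N \<and> holds D \<alpha> (the \<circ> \<mu>)}"
    using plan_eval_valuations[OF assms(1) N, of D] assms(2) assms(3)[OF N]
    by (auto simp: valuations_on_def)
qed

lemma implementsD:
  assumes "implements S I F \<alpha> E"
  shows "wf_plan S I E" "attrs I E = attrs I F \<union> out_vars \<alpha>"
    and "\<And>D N \<mu>. N \<subseteq> valuations_on I \<Longrightarrow> \<mu> \<in> plan_eval I E D N \<longleftrightarrow>
      dom \<mu> = attrs I F \<union> out_vars \<alpha> \<and> \<mu> |` attrs I F \<in> plan_eval I F D N \<and> holds D \<alpha> (the \<circ> \<mu>)"
  using assms unfolding implements_def by (auto simp: valuations_on_def)

lemma restrict_dom_id: "dom \<mu> \<subseteq> Z \<Longrightarrow> \<mu> |` Z = \<mu>"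
  by (rule ext) (metis domIff restrict_in restrict_out subsetD)

text \<open>Inverts a generalized projection that keeps all attributes: its result determines the
  argument tuple.\<close>

lemma restrict_upd_iff:
  assumes "dom \<mu> = insert x Z" "dom \<kappa> = Z" "x \<notin> Z"
  shows "\<mu> = (\<kappa> |` Z)(x := w) \<longleftrightarrow> \<mu> |` Z = \<kappa> \<and> \<mu> x = w"
proof
  have \<kappa>: "\<kappa> |` Z = \<kappa>" using assms by (simp add: restrict_dom_id)
  then show "\<mu> |` Z = \<kappa> \<and> \<mu> x = w" if "\<mu> = (\<kappa> |` Z)(x := w)"
    using that assms(3) by simp
  have "\<mu> = (\<mu> |` Z)(x := \<mu> x)"
  proof
    show "\<mu> v = ((\<mu> |` Z)(x := \<mu> x)) v" for v
      using assms(1) by (metis domIff fun_upd_apply insert_iff restrict_in restrict_out)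
  qed
  then show "\<mu> = (\<kappa> |` Z)(x := w)" if "\<mu> |` Z = \<kappa> \<and> \<mu> x = w"
    using that \<kappa> by simp
qed

text \<open>The preimage is forced to be \<open>g\<close>, which eliminates the existential
  quantifier of the image.\<close>

lemma mem_image_iff:
  assumes "\<And>\<kappa>. \<kappa> \<in> A \<Longrightarrow> \<mu> = f \<kappa> \<longleftrightarrow> g = \<kappa> \<and> P"
  shows "\<mu> \<in> {f \<kappa> | \<kappa>. \<kappa> \<in> A} \<longleftrightarrow> g \<in> A \<and> P"
  unfolding mem_Collect_eq using assms by metis

section \<open>Construction of the plan\<close>

text \<open>\<open>F\<close> must vary in the induction: for \<open>Comp\<close> and
  \<open>Diff\<close>, the plan for \<open>b\<close> starts from a projection. Keeping the outputs
  out of the schema of \<open>F\<close> is what access joins and generalized projections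
  demand.\<close>

lemma implementing_plan_exists:
  fixes F :: "('r, 'v, 'd) plan"
  assumes "flif_over S \<alpha>" "io_disjoint \<alpha>" "wf_plan S I F"
    and "in_vars \<alpha> \<subseteq> attrs I F" "attrs I F \<inter> out_vars \<alpha> = {}"
  shows "\<exists>E. implements S I F \<alpha> E"
  using assms
proof (induction \<alpha> arbitrary: F)
  case (Atom R xs ys)
  have "io_disjoint (Atom R xs ys :: ('r, 'v, 'd) flif)" by (rule Atom)
  then have "implements S I F (Atom R xs ys) (Access F R xs ys)"
    using Atom.prems by (intro implementsI) (auto simp: valuations_on_def)
  then show ?case ..
next
  case (EqVar x y)
  have "implements S I F (EqVar x y) (SelectVar x y F)"
  proof (rule implementsI)
    fix D N and \<mu> :: "'v \<rightharpoonup> 'd"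
    assume "dom \<mu> = attrs I F \<union> out_vars (EqVar x y :: ('r, 'v, 'd) flif)"
    then have dom: "dom \<mu> = attrs I F" by simp
    \<comment> \<open>Both attributes are defined, so comparing options amounts to comparing
      values.\<close>
    then have "x \<in> dom \<mu>" "y \<in> dom \<mu>" using EqVar.prems by auto
    then obtain p q where "\<mu> x = Some p" "\<mu> y = Some q" by blast
    then show "\<mu> \<in> plan_eval I (SelectVar x y F) D N \<longleftrightarrow>
        \<mu> |` attrs I F \<in> plan_eval I F D N \<and> holds D (EqVar x y) (the \<circ> \<mu>)"
      using dom by (auto simp: restrict_dom_id)
  qed (use EqVar.prems in auto)
  then show ?case ..
next
  case (EqConst x c)
  have "implements S I F (EqConst x c) (SelectConst x c F)"
  proof (rule implementsI)
    fix D N and \<mu> :: "'v \<rightharpoonup> 'd"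
    assume "dom \<mu> = attrs I F \<union> out_vars (EqConst x c :: ('r, 'v, 'd) flif)"
    then have dom: "dom \<mu> = attrs I F" by simp
    then have "x \<in> dom \<mu>" using EqConst.prems by auto
    then obtain p where "\<mu> x = Some p" by blast
    then show "\<mu> \<in> plan_eval I (SelectConst x c F) D N \<longleftrightarrow>
        \<mu> |` attrs I F \<in> plan_eval I F D N \<and> holds D (EqConst x c) (the \<circ> \<mu>)"
      using dom by (auto simp: restrict_dom_id)
  qed (use EqConst.prems in auto)
  then show ?case ..
next
  case (AssignVar x y)
  let ?Z = "attrs I F"
  let ?E = "GenProjVar ?Z x y F"
  have wf: "wf_plan S I ?E" and x: "x \<notin> ?Z" and y: "y \<in> ?Z"
    using AssignVar.prems by auto
  have "implements S I F (AssignVar x y) ?E"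
  proof (rule implementsI)
    fix D and N :: "('v \<rightharpoonup> 'd) set" and \<mu> :: "'v \<rightharpoonup> 'd"
    assume N: "N \<subseteq> valuations_on I"
      and "dom \<mu> = ?Z \<union> out_vars (AssignVar x y :: ('r, 'v, 'd) flif)"
    then have dom: "dom \<mu> = insert x ?Z" by simp
    have F: "dom \<kappa> = ?Z" if "\<kappa> \<in> plan_eval I F D N" for \<kappa>
      using that plan_eval_valuations[OF AssignVar.prems(3) N, of D]
      unfolding valuations_on_def by blast
    have holds: "holds D (AssignVar x y) (the \<circ> \<mu>) \<longleftrightarrow> \<mu> x = \<mu> y"
    proof -
      have "x \<in> dom \<mu>" "y \<in> dom \<mu>" using dom y by auto
      then obtain p q where "\<mu> x = Some p" "\<mu> y = Some q" by blast
      then show ?thesis by auto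
    qed
    have ext: "\<mu> = (\<kappa> |` ?Z)(x := \<kappa> y) \<longleftrightarrow> \<mu> |` ?Z = \<kappa> \<and> \<mu> x = \<mu> y"
      if "\<kappa> \<in> plan_eval I F D N" for \<kappa>
    proof -
      \<comment> \<open>The copied attribute \<open>y\<close> is itself kept, so its value can be
        read off the result.\<close>
      have "\<kappa> y = \<mu> y" if "\<mu> |` ?Z = \<kappa>"
        using fun_cong[OF that, of y] y by simp
      then have "\<mu> |` ?Z = \<kappa> \<and> \<mu> x = \<kappa> y \<longleftrightarrow> \<mu> |` ?Z = \<kappa> \<and> \<mu> x = \<mu> y"
        by auto
      then show ?thesis
        using restrict_upd_iff[OF dom F[OF that] x, of "\<kappa> y"] by (rule trans[rotated])
    qed
    show "\<mu> \<in> plan_eval I ?E D N \<longleftrightarrow>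
        \<mu> |` ?Z \<in> plan_eval I F D N \<and> holds D (AssignVar x y) (the \<circ> \<mu>)"
      unfolding holds plan_eval.simps by (rule mem_image_iff[OF ext])
  qed (use wf in auto)
  then show ?case ..
next
  case (AssignConst x c)
  let ?Z = "attrs I F"
  let ?E = "GenProjConst ?Z x c F"
  have wf: "wf_plan S I ?E" and x: "x \<notin> ?Z"
    using AssignConst.prems by auto
  have "implements S I F (AssignConst x c) ?E"
  proof (rule implementsI)
    fix D and N :: "('v \<rightharpoonup> 'd) set" and \<mu> :: "'v \<rightharpoonup> 'd"
    assume N: "N \<subseteq> valuations_on I"
      and "dom \<mu> = ?Z \<union> out_vars (AssignConst x c :: ('r, 'v, 'd) flif)"
    then have dom: "dom \<mu> = insert x ?Z" by simp
    have F: "dom \<kappa> = ?Z" if "\<kappa> \<in> plan_eval I F D N" for \<kappa>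
      using that plan_eval_valuations[OF AssignConst.prems(3) N, of D]
      unfolding valuations_on_def by blast
    have holds: "holds D (AssignConst x c) (the \<circ> \<mu>) \<longleftrightarrow> \<mu> x = Some c"
    proof -
      have "x \<in> dom \<mu>" using dom by auto
      then obtain p where "\<mu> x = Some p" by blast
      then show ?thesis by auto
    qed
    have ext: "\<mu> = (\<kappa> |` ?Z)(x := Some c) \<longleftrightarrow> \<mu> |` ?Z = \<kappa> \<and> \<mu> x = Some c"
      if "\<kappa> \<in> plan_eval I F D N" for \<kappa>
      by (rule restrict_upd_iff[OF dom F[OF that] x])
    show "\<mu> \<in> plan_eval I ?E D N \<longleftrightarrow>
        \<mu> |` ?Z \<in> plan_eval I F D N \<and> holds D (AssignConst x c) (the \<circ> \<mu>)"
      unfolding holds plan_eval.simps by (rule mem_image_iff[OF ext])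
  qed (use wf in auto)
  then show ?case ..
next
  case (Comp a b)
  note io = io_disjoint_CompD[OF Comp.prems(2)]
  let ?Z = "attrs I F" and ?A = "out_vars a" and ?B = "out_vars b"
  have Z: "in_vars a \<subseteq> ?Z" "in_vars b \<subseteq> ?Z \<union> ?A" "?Z \<inter> ?A = {}" "?Z \<inter> ?B = {}"
    using Comp.prems by auto
  obtain Ea where Ea: "implements S I F a Ea"
    using Comp.IH(1)[of F] Comp.prems io Z by auto
  note a = implementsD[OF Ea]
  \<comment> \<open>\<open>b\<close> overwrites the common outputs, which therefore have to be projected away first.\<close>
  let ?P = "Project (?Z \<union> (?A - ?B)) Ea"
  \<comment> \<open>Inputs of \<open>b\<close> lie in \<open>?Z\<close> or \<open>?A\<close>, and
    io-disjointness of \<open>b\<close> keeps them out of \<open>?B\<close>, so the projection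
    retains them.\<close>
  have P: "wf_plan S I ?P" "in_vars b \<subseteq> attrs I ?P" "attrs I ?P \<inter> ?B = {}"
    using a(1,2) Z io_disjointD[OF io(2)] by auto
  obtain Eb where Eb: "implements S I ?P b Eb"
    using Comp.IH(2)[OF _ io(2) P] Comp.prems(1) by auto
  note b = implementsD[OF Eb]
  have "implements S I F (Comp a b) Eb"
  proof (rule implementsI)
    fix D and N :: "('v \<rightharpoonup> 'd) set" and \<mu> :: "'v \<rightharpoonup> 'd"
    assume N: "N \<subseteq> valuations_on I" and "dom \<mu> = ?Z \<union> out_vars (Comp a b)"
    then have dom: "dom \<mu> = ?Z \<union> ?A \<union> ?B" by auto
    \<comment> \<open>Projection quantifies existentially over the removed attributes
      \<open>?A \<inter> ?B\<close>, exactly as the \<open>Comp\<close> clause of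
      \<open>holds\<close> does. Hence \<open>Eb\<close> is already the plan for the
      composition.\<close>
    have "\<mu> |` attrs I ?P \<in> plan_eval I ?P D N \<longleftrightarrow> \<mu> |` ?Z \<in> plan_eval I F D N \<and>
        (\<exists>\<nu>. (\<forall>v. v \<notin> ?A \<inter> ?B \<longrightarrow> \<nu> v = (the \<circ> \<mu>) v) \<and> holds D a \<nu>)" (is "?L \<longleftrightarrow> ?R")
    proof
      assume ?L
      then obtain \<kappa> where eq: "\<mu> |` (?Z \<union> (?A - ?B)) = \<kappa> |` (?Z \<union> (?A - ?B))"
        and \<kappa>: "\<kappa> \<in> plan_eval I Ea D N" by auto
      have eq': "\<mu> v = \<kappa> v" if "v \<in> ?Z \<union> (?A - ?B)" for v
        using fun_cong[OF eq, of v] that by (simp only: restrict_in)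
      have "\<mu> |` ?Z = \<kappa> |` ?Z"
        using eq' by (auto simp: restrict_map_def fun_eq_iff)
      moreover have "\<kappa> |` ?Z \<in> plan_eval I F D N" "holds D a (the \<circ> \<kappa>)"
        using \<kappa> a(3)[OF N] by auto
      moreover let ?\<nu> = "\<lambda>v. if v \<in> ?A \<inter> ?B then the (\<kappa> v) else the (\<mu> v)"
      have "holds D a ?\<nu> \<longleftrightarrow> holds D a (the \<circ> \<kappa>)"
        by (rule holds_cong) (use eq' Z(1) in \<open>auto simp: vars_eq_in_out\<close>)
      ultimately show ?R by (auto intro!: exI[of _ ?\<nu>])
    next
      assume ?R
      then obtain \<nu> where F: "\<mu> |` ?Z \<in> plan_eval I F D N"
        and \<nu>: "\<And>v. v \<notin> ?A \<inter> ?B \<Longrightarrow> \<nu> v = the (\<mu> v)" "holds D a \<nu>" by auto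
      \<comment> \<open>The tuple of \<open>Ea\<close> before projection: \<open>\<nu>\<close> cut
        down to the schema of \<open>Ea\<close>, equal to \<open>\<mu>\<close> on the attributes
        that are kept.\<close>
      let ?\<kappa> = "(Some \<circ> \<nu>) |` (?Z \<union> ?A)"
      have eq: "?\<kappa> v = \<mu> v" if "v \<in> ?Z \<union> (?A - ?B)" for v
      proof -
        have "v \<in> dom \<mu>" "v \<notin> ?A \<inter> ?B" "v \<in> ?Z \<union> ?A" using that dom Z by auto
        then show ?thesis using \<nu>(1)[of v] by auto
      qed
      have "?\<kappa> |` ?Z = \<mu> |` ?Z"
      proof
        show "(?\<kappa> |` ?Z) v = (\<mu> |` ?Z) v" for v
          using eq[of v] by (cases "v \<in> ?Z") (simp_all only: restrict_in restrict_out Un_iff simp_thms)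
      qed
      moreover have "?\<kappa> |` (?Z \<union> (?A - ?B)) = \<mu> |` (?Z \<union> (?A - ?B))"
      proof
        show "(?\<kappa> |` (?Z \<union> (?A - ?B))) v = (\<mu> |` (?Z \<union> (?A - ?B))) v" for v
          using eq[of v]
          by (cases "v \<in> ?Z \<union> (?A - ?B)") (simp_all only: restrict_in restrict_out simp_thms)
      qed
      moreover have "holds D a (the \<circ> ?\<kappa>) \<longleftrightarrow> holds D a \<nu>"
        by (rule holds_cong) (use Z(1) in \<open>auto simp: vars_eq_in_out\<close>)
      moreover have "dom ?\<kappa> = ?Z \<union> ?A" by (auto simp: restrict_map_def split: if_splits)
      ultimately have "?\<kappa> \<in> plan_eval I Ea D N" using a(3)[OF N] F \<nu> by simp
      moreover have "\<mu> |` attrs I ?P = ?\<kappa> |` (?Z \<union> (?A - ?B))"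
        using \<open>?\<kappa> |` (?Z \<union> (?A - ?B)) = \<mu> |` (?Z \<union> (?A - ?B))\<close> by simp
      ultimately show ?L unfolding plan_eval.simps by blast
    qed
    then show "\<mu> \<in> plan_eval I Eb D N \<longleftrightarrow>
        \<mu> |` ?Z \<in> plan_eval I F D N \<and> holds D (Comp a b) (the \<circ> \<mu>)"
      using b(3)[OF N] dom by auto
  qed (use b(1,2) in auto)
  then show ?case ..
next
  case (Union a b)
  note io = io_disjoint_UnionD[OF Union.prems(2)]
  obtain Ea where Ea: "implements S I F a Ea"
    using Union.IH(1)[of F] Union.prems io by auto
  obtain Eb where Eb: "implements S I F b Eb"
    using Union.IH(2)[of F] Union.prems io by auto
  have "implements S I F (Union a b) (PUnion Ea Eb)"
    using implementsD[OF Ea] implementsD[OF Eb] io by (intro implementsI) auto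
  then show ?case ..
next
  case (Diff a b)
  note io = io_disjoint_DiffD[OF Diff.prems(2)]
  let ?Z = "attrs I F" and ?A = "out_vars a" and ?B = "out_vars b"
  have Z: "in_vars a \<subseteq> ?Z" "in_vars b \<subseteq> ?Z" "?Z \<inter> ?A = {}" "?B - ?A \<subseteq> ?Z"
    using Diff.prems by auto
  obtain Ea where Ea: "implements S I F a Ea"
    using Diff.IH(1)[of F] Diff.prems io Z by auto
  note a = implementsD[OF Ea]
  \<comment> \<open>The outputs of \<open>b\<close> that are not outputs of \<open>a\<close> are inputs of \<open>Diff a b\<close>, so they occur in \<open>F\<close>.\<close>
  let ?P = "Project (?Z - ?B) F"
  have P: "wf_plan S I ?P" "in_vars b \<subseteq> attrs I ?P" "attrs I ?P \<inter> ?B = {}"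
    using Diff.prems(3) Z io_disjointD[OF io(2)] by auto
  obtain Eb where Eb: "implements S I ?P b Eb"
    using Diff.IH(2)[OF _ io(2) P] Diff.prems(1) by auto
  note b = implementsD[OF Eb]
  \<comment> \<open>The two arguments of the difference have equal schemas because
    \<open>?A \<subseteq> ?B\<close> and \<open>?B - ?A \<subseteq> ?Z\<close>.\<close>
  have schema: "?Z - ?B \<union> ?B = ?Z \<union> ?A" using Z io by auto
  have "implements S I F (Diff a b) (PDiff Ea Eb)"
  proof (rule implementsI)
    fix D and N :: "('v \<rightharpoonup> 'd) set" and \<mu> :: "'v \<rightharpoonup> 'd"
    assume N: "N \<subseteq> valuations_on I" and "dom \<mu> = ?Z \<union> out_vars (Diff a b)"
    then have dom: "dom \<mu> = ?Z \<union> ?A" by simp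
    \<comment> \<open>\<open>Eb\<close> may contain tuples that do not extend a tuple of
      \<open>F\<close>, as it recomputes the attributes in \<open>?B - ?A\<close>. For extensions of
      tuples of \<open>F\<close>, however, membership in \<open>Eb\<close> reduces to
      \<open>holds D b\<close>, so subtracting it is correct.\<close>
    have "\<mu> |` (?Z - ?B) \<in> plan_eval I ?P D N" if "\<mu> |` ?Z \<in> plan_eval I F D N"
    proof -
      have "\<mu> |` (?Z - ?B) = (\<mu> |` ?Z) |` (?Z - ?B)" by (simp add: Int_absorb1 Diff_subset)
      then show ?thesis using that unfolding plan_eval.simps by blast
    qed
    then show "\<mu> \<in> plan_eval I (PDiff Ea Eb) D N \<longleftrightarrow>
        \<mu> |` ?Z \<in> plan_eval I F D N \<and> holds D (Diff a b) (the \<circ> \<mu>)"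
      using a(3)[OF N] b(3)[OF N] dom schema by auto
  qed (use a(1,2) b(1,2) schema in auto)
  then show ?case ..
qed

theorem theorem7p1:
  fixes S :: "'r schema" and \<alpha> :: "('r, 'v, 'd) flif"
  assumes "valid_schema S" and "flif_over S \<alpha>" and "io_disjoint \<alpha>"
  shows "\<exists>E :: ('r, 'v, 'd) plan.
           is_plan S (in_vars \<alpha>) E \<and> attrs (in_vars \<alpha>) E = vars \<alpha> \<and>
           (\<forall>D N. is_instance S D \<and> N \<subseteq> valuations_on (in_vars \<alpha>) \<longrightarrow>
              Eval \<alpha> D N = plan_eval (in_vars \<alpha>) E D N)"
proof -
  \<comment> \<open>\<open>In\<close> has schema \<open>in_vars \<alpha>\<close>, which covers the
    inputs and, by io-disjointness, avoids the outputs.\<close>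
  obtain E where E: "implements S (in_vars \<alpha>) In \<alpha> E"
    using implementing_plan_exists[of S \<alpha> "in_vars \<alpha>" In] assms io_disjointD by auto
  have "finite (in_vars \<alpha>)"
    using finite_vars[of \<alpha>] by (simp add: vars_eq_in_out)
  moreover have "Eval \<alpha> D N = plan_eval (in_vars \<alpha>) E D N"
    if "N \<subseteq> valuations_on (in_vars \<alpha>)" for D N
    using E that Eval_eq[OF assms(3) that, of D] by (simp add: implements_def vars_eq_in_out)
  ultimately show ?thesis
    using implementsD(1,2)[OF E] by (auto simp: is_plan_def vars_eq_in_out)
qed

end
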